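(* The family $B_{\mathcal M}$ of meager downward-closed subsets of $[\omega]^\omega$ is a prime ideal in the lattice $\mathcal M([\omega]^\omega)$ of all downward-closed subsets of $[\omega]^\omega$.
   Context: $2^\omega$ carries the product topology (two-point discrete factors); meager means first category in this topology. Subsets of $\omega$ are identified with their characteristic functions, and $[\omega]^\omega \subseteq 2^\omega$ is the set of infinite subsets of $\omega$. For $x,y \subseteq \omega$, write $x \le y$ if $x - y$ is finite. A set $X \subseteq [\omega]^\omega$ is downward-closed if whenever $x \in X$, $y \in [\omega]^\omega$ and $y \le x$, then $y \in X$. $\mathcal M([\omega]^\omega)$ is the lattice of downward-closed subsets of $[\omega]^\omega$, ordered by inclusion (with meet $\cap$ and join $\cup$). *)

theory Defs
  imports "HOL-Analysis.Analysis" "HOL-Algebra.Complete_Lattice"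
begin

section \<open>Meager sets in the Cantor space\<close>

definition nowhere_dense_in :: "'a topology \<Rightarrow> 'a set \<Rightarrow> bool" where
  "nowhere_dense_in T S \<longleftrightarrow> S \<subseteq> topspace T \<and> T interior_of (T closure_of S) = {}"

definition meager_in :: "'a topology \<Rightarrow> 'a set \<Rightarrow> bool" where
  "meager_in T S \<longleftrightarrow>
    (\<exists>\<N>. countable \<N> \<and> (\<forall>N\<in>\<N>. nowhere_dense_in T N) \<and> S = \<Union>\<N>)"

definition cantor_space :: "(nat \<Rightarrow> bool) topology" where
  "cantor_space = product_topology (\<lambda>_. discrete_topology UNIV) UNIV"

definition char_fun :: "nat set \<Rightarrow> nat \<Rightarrow> bool" where
  "char_fun x = (\<lambda>n. n \<in> x)"

text \<open>Meagerness of a family of subsets of \<open>\<omega>\<close>, through the identification of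
  subsets with their characteristic functions.\<close>

definition meager_family :: "nat set set \<Rightarrow> bool" where
  "meager_family X \<longleftrightarrow> meager_in cantor_space (char_fun ` X)"


section \<open>The lattice of downward-closed families\<close>

definition infinite_subsets :: "nat set set" where
  "infinite_subsets = {x. infinite x}"

definition almost_subset :: "nat set \<Rightarrow> nat set \<Rightarrow> bool"  (infix \<open>\<subseteq>\<^sup>*\<close> 50) where
  "x \<subseteq>\<^sup>* y \<longleftrightarrow> finite (x - y)"

definition downward_closed :: "nat set set \<Rightarrow> bool" where
  "downward_closed X \<longleftrightarrow> X \<subseteq> infinite_subsets \<and>
    (\<forall>x\<in>X. \<forall>y\<in>infinite_subsets. y \<subseteq>\<^sup>* x \<longrightarrow> y \<in> X)"

definition down_lattice :: "nat set set gorder" where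
  "down_lattice = \<lparr>carrier = {X. downward_closed X}, eq = (=), le = (\<subseteq>)\<rparr>"

definition B_M :: "nat set set set" where
  "B_M = {X. downward_closed X \<and> meager_family X}"


section \<open>Prime ideals in lattices\<close>

locale lattice_ideal = Lattice.lattice L for L (structure) +
  fixes I
  assumes subset_carrier: "I \<subseteq> carrier L"
    and nonempty: "I \<noteq> {}"
    and down_closed: "\<lbrakk>b \<in> I; a \<in> carrier L; a \<sqsubseteq> b\<rbrakk> \<Longrightarrow> a \<in> I"
    and join_mem: "\<lbrakk>a \<in> I; b \<in> I\<rbrakk> \<Longrightarrow> a \<squnion> b \<in> I"

locale lattice_prime_ideal = lattice_ideal +
  assumes proper: "I \<noteq> carrier L"
    and prime: "\<lbrakk>a \<in> carrier L; b \<in> carrier L; a \<sqinter> b \<in> I\<rbrakk> \<Longrightarrow> a \<in> I \<or> b \<in> I"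


section \<open>The lattice operations are union and intersection\<close>

lemma downward_closed_Un: "downward_closed X \<Longrightarrow> downward_closed Y \<Longrightarrow> downward_closed (X \<union> Y)"
  unfolding downward_closed_def by blast

lemma downward_closed_Int: "downward_closed X \<Longrightarrow> downward_closed Y \<Longrightarrow> downward_closed (X \<inter> Y)"
  unfolding downward_closed_def by blast

lemma down_lattice_partial_order: "partial_order down_lattice"
  by unfold_locales (auto simp: down_lattice_def)

lemma down_lattice_least_Un:
  assumes "downward_closed X" "downward_closed Y"
  shows "least down_lattice (X \<union> Y) (Upper down_lattice {X, Y})"
  using assms downward_closed_Un[OF assms]
  by (auto simp: least_def Upper_def down_lattice_def)

lemma down_lattice_greatest_Int:
  assumes "downward_closed X" "downward_closed Y"
  shows "greatest down_lattice (X \<inter> Y) (Lower down_lattice {X, Y})"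
  using assms downward_closed_Int[OF assms]
  by (auto simp: greatest_def Lower_def down_lattice_def)

lemma down_lattice_lattice: "Lattice.lattice down_lattice"
proof -
  interpret partial_order down_lattice by (rule down_lattice_partial_order)
  show ?thesis
  proof unfold_locales
    fix X Y assume "X \<in> carrier down_lattice" "Y \<in> carrier down_lattice"
    then have XY: "downward_closed X" "downward_closed Y" by (auto simp: down_lattice_def)
    show "\<exists>s. least down_lattice s (Upper down_lattice {X, Y})"
      using down_lattice_least_Un[OF XY] by blast
    show "\<exists>s. greatest down_lattice s (Lower down_lattice {X, Y})"
      using down_lattice_greatest_Int[OF XY] by blast
  qed
qed

lemma down_lattice_join:
  assumes "downward_closed X" "downward_closed Y"
  shows "X \<squnion>\<^bsub>down_lattice\<^esub> Y = X \<union> Y"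
proof -
  interpret partial_order down_lattice by (rule down_lattice_partial_order)
  show ?thesis
    unfolding join_def sup_def
    by (rule some_equality, rule down_lattice_least_Un[OF assms],
      erule least_unique, rule down_lattice_least_Un[OF assms])
qed

lemma down_lattice_meet:
  assumes "downward_closed X" "downward_closed Y"
  shows "X \<sqinter>\<^bsub>down_lattice\<^esub> Y = X \<inter> Y"
proof -
  interpret partial_order down_lattice by (rule down_lattice_partial_order)
  show ?thesis
    unfolding meet_def inf_def
    by (rule some_equality, rule down_lattice_greatest_Int[OF assms],
      erule greatest_unique, rule down_lattice_greatest_Int[OF assms])
qed

end

(*
  A downward-closed family X is meager iff there is g with g n > n such that every x in X contains
  only finitely many of the intervals {n..<g n}: for the nontrivial direction, g n is chosen so that
  some pattern on {n..<g n} avoids the first n nowhere dense sets whatever happens below n, and an x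
  containing infinitely many intervals has an infinite subset realising infinitely many patterns.
  If g witnesses meagerness of X \<inter> Y while Y is not meager, some y in Y contains {n..<g n} for
  all n in an infinite set A. Coarsening g to h n = g (next element of A after n), an x in X with
  infinitely many {n..<h n} would give x \<inter> y in X \<inter> Y with infinitely many {n..<g n};
  so h witnesses meagerness of X.
*)
theory Submission
  imports Defs
begin

section \<open>Cylinders and nowhere dense sets in the Cantor space\<close>

definition cylinder :: "(nat \<Rightarrow> bool) \<Rightarrow> nat \<Rightarrow> (nat \<Rightarrow> bool) set" where
  "cylinder s n = {f. \<forall>i<n. f i = s i}"

lemma topspace_cantor_space [simp]: "topspace cantor_space = UNIV"
  by (simp add: cantor_space_def)

lemma openin_cylinder: "openin cantor_space (cylinder s n)"
proof -
  have "cylinder s n = (\<Pi>\<^sub>E i\<in>UNIV. if i < n then {s i} else UNIV)"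
  proof (intro equalityI subsetI)
    fix f assume "f \<in> (\<Pi>\<^sub>E i\<in>UNIV. if i < n then {s i} else UNIV)"
    then have "f i \<in> (if i < n then {s i} else UNIV)" for i by (rule PiE_mem) simp
    then have "f i = s i" if "i < n" for i using that by (metis singletonD)
    then show "f \<in> cylinder s n" by (simp add: cylinder_def)
  qed (simp add: cylinder_def PiE_iff)
  moreover have "finite {i::nat. (if i < n then {s i} else UNIV) \<noteq> UNIV}"
    by (rule finite_subset[of _ "{..<n}"]) auto
  ultimately show ?thesis
    by (simp add: cantor_space_def openin_PiE_gen)
qed

lemma openin_cantor_space_cylinder:
  assumes "openin cantor_space U" "f \<in> U"
  obtains n where "cylinder f n \<subseteq> U"
proof -
  obtain V where V: "finite {i. V i \<noteq> UNIV}" "f \<in> Pi\<^sub>E UNIV V" "Pi\<^sub>E UNIV V \<subseteq> U"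
    using assms by (auto simp: cantor_space_def openin_product_topology_alt)
  obtain n where n: "{i. V i \<noteq> UNIV} \<subseteq> {..<n}"
    using V(1) finite_nat_iff_bounded by blast
  have "cylinder f n \<subseteq> Pi\<^sub>E UNIV V"
  proof
    fix h assume h: "h \<in> cylinder f n"
    have "h i \<in> V i" for i
    proof (cases "i < n")
      case True
      then show ?thesis using h V(2) by (auto simp: cylinder_def PiE_iff)
    next
      case False
      then show ?thesis using n by auto
    qed
    then show "h \<in> Pi\<^sub>E UNIV V" by (auto simp: PiE_iff)
  qed
  then show ?thesis using that V(3) by blast
qed

text \<open>The working form of nowhere density: later arguments extend finite prefixes instead of
  handling closures. Asking for \<open>n \<le> m\<close> lets such extensions be chained.\<close>

lemma nowhere_dense_in_cantor_space_iff:
  "nowhere_dense_in cantor_space S \<longleftrightarrow>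
    (\<forall>s n. \<exists>t m. n \<le> m \<and> (\<forall>i<n. t i = s i) \<and> cylinder t m \<inter> S = {})"
proof
  assume nd: "nowhere_dense_in cantor_space S"
  show "\<forall>s n. \<exists>t m. n \<le> m \<and> (\<forall>i<n. t i = s i) \<and> cylinder t m \<inter> S = {}"
  proof (intro allI)
    fix s n
    let ?C = "cantor_space closure_of S"
    have "\<not> cylinder s n \<subseteq> ?C"
    proof
      assume "cylinder s n \<subseteq> ?C"
      then have "cylinder s n \<subseteq> cantor_space interior_of ?C"
        by (rule interior_of_maximal[OF _ openin_cylinder])
      moreover have "s \<in> cylinder s n" by (simp add: cylinder_def)
      ultimately show False using nd by (auto simp: nowhere_dense_in_def)
    qed
    then obtain t where t: "t \<in> cylinder s n" "t \<notin> ?C" by blast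
    have "openin cantor_space (topspace cantor_space - ?C)"
      by (intro openin_diff openin_topspace closedin_closure_of)
    then obtain k where k: "cylinder t k \<subseteq> topspace cantor_space - ?C"
      using openin_cantor_space_cylinder t(2) by (metis DiffI UNIV_I topspace_cantor_space)
    \<comment> \<open>The length \<open>max n k\<close> keeps the cylinder inside the open set and
      also meets the demand \<open>n \<le> m\<close>.\<close>
    have "cylinder t (max n k) \<subseteq> cylinder t k" by (auto simp: cylinder_def)
    moreover have "S \<subseteq> ?C" by (simp add: closure_of_subset)
    ultimately have "cylinder t (max n k) \<inter> S = {}"
      using k by blast
    then show "\<exists>t m. n \<le> m \<and> (\<forall>i<n. t i = s i) \<and> cylinder t m \<inter> S = {}"
      using t(1) by (intro exI[of _ t] exI[of _ "max n k"]) (auto simp: cylinder_def)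
  qed
next
  assume ext: "\<forall>s n. \<exists>t m. n \<le> m \<and> (\<forall>i<n. t i = s i) \<and> cylinder t m \<inter> S = {}"
  let ?I = "cantor_space interior_of (cantor_space closure_of S)"
  have False if f: "f \<in> ?I" for f
  proof -
    obtain n where n: "cylinder f n \<subseteq> ?I"
      using openin_cantor_space_cylinder[OF openin_interior_of f] .
    obtain t m where t: "n \<le> m" "\<forall>i<n. t i = f i" "cylinder t m \<inter> S = {}"
      using ext[rule_format, of n f] by blast
    \<comment> \<open>\<open>t\<close> still extends the first \<open>n\<close> values of
      \<open>f\<close>, so it lies in the closure of \<open>S\<close>, and its neighbourhood
      \<open>cylinder t m\<close> has to meet \<open>S\<close>.\<close>
    have "t \<in> cylinder f n" "t \<in> cylinder t m" using t by (auto simp: cylinder_def)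
    then have "t \<in> cantor_space closure_of S"
      using n interior_of_subset[of cantor_space "cantor_space closure_of S"] by blast
    then have "\<exists>y. y \<in> S \<and> y \<in> cylinder t m"
      using \<open>t \<in> cylinder t m\<close> openin_cylinder[of t m] by (auto simp: in_closure_of)
    then show False using t(3) by blast
  qed
  then show "nowhere_dense_in cantor_space S"
    by (auto simp: nowhere_dense_in_def)
qed

section \<open>Meager sets\<close>

lemma nowhere_dense_in_subset:
  assumes "nowhere_dense_in T S" "R \<subseteq> S"
  shows "nowhere_dense_in T R"
proof -
  have "T interior_of (T closure_of R) \<subseteq> T interior_of (T closure_of S)"
    using assms(2) by (intro interior_of_mono closure_of_mono)
  then show ?thesis using assms by (auto simp: nowhere_dense_in_def)
qed

lemma meager_in_subset:
  assumes "meager_in T S" "R \<subseteq> S"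
  shows "meager_in T R"
proof -
  obtain \<N> where N: "countable \<N>" "\<forall>N\<in>\<N>. nowhere_dense_in T N" "S = \<Union>\<N>"
    using assms(1) by (auto simp: meager_in_def)
  have "R = \<Union>((\<lambda>N. N \<inter> R) ` \<N>)" using N(3) assms(2) by blast
  moreover have "\<forall>M\<in>(\<lambda>N. N \<inter> R) ` \<N>. nowhere_dense_in T M"
    using N(2) nowhere_dense_in_subset by blast
  moreover have "countable ((\<lambda>N. N \<inter> R) ` \<N>)" using N(1) by simp
  ultimately show ?thesis unfolding meager_in_def by blast
qed

lemma meager_in_Un:
  assumes "meager_in T R" "meager_in T S"
  shows "meager_in T (R \<union> S)"
proof -
  obtain \<M> \<N> where "countable \<M>" "\<forall>N\<in>\<M>. nowhere_dense_in T N" "R = \<Union>\<M>"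
    and "countable \<N>" "\<forall>N\<in>\<N>. nowhere_dense_in T N" "S = \<Union>\<N>"
    using assms by (auto simp: meager_in_def)
  then show ?thesis
    unfolding meager_in_def by (intro exI[of _ "\<M> \<union> \<N>"]) auto
qed

lemma meager_in_sequence:
  assumes "meager_in T S"
  obtains N :: "nat \<Rightarrow> 'a set" where "\<And>i. nowhere_dense_in T (N i)" "S = (\<Union>i. N i)"
proof -
  obtain \<N> where N: "countable \<N>" "\<forall>N\<in>\<N>. nowhere_dense_in T N" "S = \<Union>\<N>"
    using assms by (auto simp: meager_in_def)
  have emp: "nowhere_dense_in T {}" by (simp add: nowhere_dense_in_def)
  \<comment> \<open>Adding the empty set makes the family nonempty, as an enumeration by all natural
    numbers requires.\<close>
  have "countable (insert {} \<N>)" using N(1) by simp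
  then have r: "range (from_nat_into (insert {} \<N>)) = insert {} \<N>"
    by (simp add: range_from_nat_into)
  show ?thesis
  proof (rule that)
    show "nowhere_dense_in T (from_nat_into (insert {} \<N>) i)" for i
      using r N(2) emp by (metis insert_iff rangeI)
    show "S = (\<Union>i. from_nat_into (insert {} \<N>) i)" using r N(3) by simp
  qed
qed

section \<open>Patterns avoiding nowhere dense sets\<close>

text \<open>The pairs in \<open>P\<close> are treated one after the other, each time lengthening
  \<open>t\<close>. Only the values of \<open>t\<close> from \<open>n\<close> on enter the
  cylinders, so one \<open>t\<close> can serve all prefixes \<open>s\<close>. The fixed start
  \<open>t0\<close> lets the caller prescribe some of these values.\<close>

lemma finite_nowhere_dense_pattern:
  assumes "finite P" "\<And>s S. (s, S) \<in> P \<Longrightarrow> nowhere_dense_in cantor_space S" "n \<le> m0"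
  shows "\<exists>t m. m0 \<le> m \<and> (\<forall>i<m0. t i = t0 i) \<and>
    (\<forall>(s, S)\<in>P. cylinder (\<lambda>j. if j < n then s j else t j) m \<inter> S = {})"
  using assms(1,2)
proof (induction P rule: finite_induct)
  case empty
  then show ?case by auto
next
  case (insert p P)
  obtain s S where p: "p = (s, S)" by (cases p)
  have "\<exists>t m. m0 \<le> m \<and> (\<forall>i<m0. t i = t0 i) \<and>
      (\<forall>(s, S)\<in>P. cylinder (\<lambda>j. if j < n then s j else t j) m \<inter> S = {})"
    using insert.prems by (intro insert.IH) auto
  then obtain t m where t: "m0 \<le> m" "\<forall>i<m0. t i = t0 i"
    and tP: "\<forall>(s, S)\<in>P. cylinder (\<lambda>j. if j < n then s j else t j) m \<inter> S = {}"
    by blast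
  have "nowhere_dense_in cantor_space S" using insert.prems p by blast
  then have "\<exists>u k. m \<le> k \<and> (\<forall>i<m. u i = (if i < n then s i else t i)) \<and> cylinder u k \<inter> S = {}"
    unfolding nowhere_dense_in_cantor_space_iff by (elim allE)
  then obtain u k where u: "m \<le> k" "\<forall>i<m. u i = (if i < n then s i else t i)"
    "cylinder u k \<inter> S = {}"
    by blast
  \<comment> \<open>Below \<open>n\<close> the sequence \<open>u\<close> carries the prefix
    \<open>s\<close> of the new pair; putting \<open>t\<close> back there makes \<open>v\<close>
    agree with \<open>t\<close> up to \<open>m\<close>.\<close>
  define v where "v j = (if j < n then t j else u j)" for j
  have vt: "v i = t i" if "i < m" for i
    using u(2) that by (simp add: v_def)
  have "cylinder (\<lambda>j. if j < n then s j else v j) k = cylinder u k"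
  proof -
    have "(\<lambda>j. if j < n then s j else v j) = u"
    proof
      fix j show "(if j < n then s j else v j) = u j"
        using u(2) assms(3) t(1) by (auto simp: v_def)
    qed
    then show ?thesis by simp
  qed
  \<comment> \<open>The pairs treated earlier stay avoided, because lengthening \<open>t\<close> to
    \<open>v\<close> only shrinks their cylinders.\<close>
  moreover have "cylinder (\<lambda>j. if j < n then r j else v j) k
      \<subseteq> cylinder (\<lambda>j. if j < n then r j else t j) m" for r
    using vt u(1) by (auto simp: cylinder_def)
  then have "\<forall>(s, S)\<in>P. cylinder (\<lambda>j. if j < n then s j else v j) k \<inter> S = {}"
    using tP by blast
  moreover have "m0 \<le> k" "\<forall>i<m0. v i = t0 i" using t u(1) vt by auto
  ultimately show ?case
    using u(3) p by (intro exI[of _ v] exI[of _ k]) auto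
qed

text \<open>There are finitely many prefixes below \<open>n\<close> and finitely many
  \<open>N i\<close> with \<open>i \<le> n\<close>, so a single pattern on \<open>{n..<m}\<close>
  defeats them all. The condition \<open>t n\<close> will make a set assembled from such patterns
  infinite.\<close>

lemma nowhere_dense_sequence_pattern:
  assumes "\<And>i. nowhere_dense_in cantor_space (N i)"
  shows "\<exists>m t. n < m \<and> t n \<and> (\<forall>i\<le>n. \<forall>f\<in>N i. \<exists>j. n \<le> j \<and> j < m \<and> f j \<noteq> t j)"
proof -
  let ?P = "(char_fun ` Pow {..<n}) \<times> (N ` {..n})"
  have "\<exists>t m. Suc n \<le> m \<and> (\<forall>i<Suc n. t i = True) \<and>
      (\<forall>(s, S)\<in>?P. cylinder (\<lambda>j. if j < n then s j else t j) m \<inter> S = {})"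
    using assms by (intro finite_nowhere_dense_pattern) auto
  then obtain t m where t: "Suc n \<le> m" "\<forall>i<Suc n. t i = True"
    and tP: "\<forall>(s, S)\<in>?P. cylinder (\<lambda>j. if j < n then s j else t j) m \<inter> S = {}"
    by blast
  have "\<exists>j. n \<le> j \<and> j < m \<and> f j \<noteq> t j" if "i \<le> n" "f \<in> N i" for i f
  proof (rule ccontr)
    assume neg: "\<not> ?thesis"
    \<comment> \<open>This is the prefix of \<open>f\<close> itself: if \<open>f\<close> agreed with
      \<open>t\<close> on \<open>{n..<m}\<close>, it would lie in an avoided cylinder.\<close>
    let ?s = "char_fun {j. j < n \<and> f j}"
    have "f \<in> cylinder (\<lambda>j. if j < n then ?s j else t j) m"
      using neg by (auto simp: cylinder_def char_fun_def)
    moreover have "(?s, N i) \<in> ?P" using that(1) by blast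
    ultimately show False using tP that(2) by blast
  qed
  then show ?thesis using t by (intro exI[of _ m] exI[of _ t]) auto
qed

section \<open>The interval criterion for meagerness\<close>

lemma meager_family_intervals:
  assumes X: "downward_closed X" and "meager_family X"
  obtains g :: "nat \<Rightarrow> nat"
    where "\<And>n. n < g n" "\<And>x. x \<in> X \<Longrightarrow> finite {n. {n..<g n} \<subseteq> x}"
proof -
  obtain N where N: "\<And>i. nowhere_dense_in cantor_space (N i)" "char_fun ` X = (\<Union>i::nat. N i)"
    using meager_in_sequence[OF assms(2)[unfolded meager_family_def]] by blast
  have "\<forall>n. \<exists>m t. n < m \<and> t n \<and> (\<forall>i\<le>n. \<forall>f\<in>N i. \<exists>j. n \<le> j \<and> j < m \<and> f j \<noteq> t j)"
    by (intro allI nowhere_dense_sequence_pattern N(1))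
  then obtain g t where g: "\<And>n. n < g n" and tn: "\<And>n. t n n"
    and t: "\<And>n i f. i \<le> n \<Longrightarrow> f \<in> N i \<Longrightarrow> \<exists>j. n \<le> j \<and> j < g n \<and> f j \<noteq> t n j"
    by metis
  have "finite {n. {n..<g n} \<subseteq> x}" if x: "x \<in> X" for x
  proof (rule ccontr)
    assume "\<not> ?thesis"
    then have inf: "\<exists>n. n \<ge> k \<and> {n..<g n} \<subseteq> x" for k
      unfolding infinite_nat_iff_unbounded_le by blast
    \<comment> \<open>Each chosen interval starts only after the previous one has ended, so patterns
      can be prescribed on them independently.\<close>
    obtain q where qx: "\<And>k. {q k..<g (q k)} \<subseteq> x" and qs: "\<And>k. g (q k) \<le> q (Suc k)"
      using dependent_nat_choice[of "\<lambda>_ n. {n..<g n} \<subseteq> x" "\<lambda>_ n n'. g n \<le> n'"] inf by blast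
    have mono: "strict_mono q"
      using g qs by (intro strict_mono_Suc_iff[THEN iffD2]) (metis less_le_trans)
    have sep: "g (q k) \<le> q l" if "k < l" for k l
      using qs[of k] that mono by (metis Suc_leI le_trans strict_mono_less_eq)
    \<comment> \<open>\<open>y\<close> copies the pattern \<open>t (q k)\<close> on each chosen
      interval and has no elements elsewhere.\<close>
    define y where "y = (\<Union>k. {j. q k \<le> j \<and> j < g (q k) \<and> t (q k) j})"
    have y_iff: "j \<in> y \<longleftrightarrow> t (q k) j" if j: "q k \<le> j" "j < g (q k)" for k j
    proof -
      have "l = k" if "q l \<le> j" "j < g (q l)" for l
        using j that sep[of k l] sep[of l k] by (cases l k rule: linorder_cases) auto
      then show ?thesis unfolding y_def using j by blast
    qed
    \<comment> \<open>Every left endpoint \<open>q k\<close> is in \<open>y\<close> because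
      \<open>t n n\<close> holds for all \<open>n\<close>.\<close>
    have "range q \<subseteq> y" using y_iff g tn by blast
    then have "infinite y"
      using mono by (meson finite_subset range_inj_infinite strict_mono_imp_inj_on)
    moreover have "y \<subseteq> x" using qx by (fastforce simp: y_def)
    then have "y \<subseteq>\<^sup>* x" by (simp add: almost_subset_def Diff_eq_empty_iff[THEN iffD2])
    ultimately have "y \<in> X"
      using X x by (auto simp: downward_closed_def infinite_subsets_def)
    then obtain i where i: "char_fun y \<in> N i" using N(2) by blast
    \<comment> \<open>The pattern at \<open>q i\<close> therefore excludes every member of
      \<open>N i\<close>, yet \<open>char_fun y\<close> realises it.\<close>
    have "i \<le> q i" using mono by (rule strict_mono_imp_increasing)
    then show False using t[OF _ i, of "q i"] y_iff by (auto simp: char_fun_def)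
  qed
  then show ?thesis using that g by blast
qed

text \<open>From some \<open>m\<close> on, no interval lies in \<open>x\<close>, so the sets
  \<open>M m\<close> cover \<open>X\<close>. Each is nowhere dense: following a prefix by enough
  values \<open>True\<close> fills an interval that starts at or after \<open>m\<close>.\<close>

lemma meager_family_if_intervals:
  assumes g: "\<And>x. x \<in> X \<Longrightarrow> finite {n. {n..<g n} \<subseteq> x}"
  shows "meager_family X"
proof -
  define M where "M m = {f::nat \<Rightarrow> bool. \<forall>n\<ge>m. \<exists>j\<in>{n..<g n}. \<not> f j}" for m :: nat
  have "nowhere_dense_in cantor_space (M m)" for m
    unfolding nowhere_dense_in_cantor_space_iff
  proof (intro allI)
    fix s n
    define k where "k = max m n"
    define t where "t j = (j < n \<longrightarrow> s j)" for j
    \<comment> \<open>The \<open>max\<close> keeps the length at least \<open>n\<close> even if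
      \<open>g k\<close> is small.\<close>
    have "cylinder t (max k (g k)) \<inter> M m = {}"
    proof -
      have "\<not> (\<exists>j\<in>{k..<g k}. \<not> f j)" if "f \<in> cylinder t (max k (g k))" for f
        using that by (auto simp: cylinder_def t_def k_def)
      moreover have "m \<le> k" by (simp add: k_def)
      ultimately show ?thesis unfolding M_def by blast
    qed
    then show "\<exists>t k. n \<le> k \<and> (\<forall>i<n. t i = s i) \<and> cylinder t k \<inter> M m = {}"
      by (intro exI[of _ t] exI[of _ "max k (g k)"]) (auto simp: t_def k_def)
  qed
  then have "meager_in cantor_space (\<Union>m. M m)"
    unfolding meager_in_def by (intro exI[of _ "range M"]) auto
  moreover have "char_fun ` X \<subseteq> (\<Union>m. M m)"
  proof
    fix f assume "f \<in> char_fun ` X"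
    then obtain x where x: "x \<in> X" "f = char_fun x" by blast
    obtain m where "{n. {n..<g n} \<subseteq> x} \<subseteq> {..<m}"
      using g[OF x(1)] finite_nat_iff_bounded by blast
    then have "\<not> {n..<g n} \<subseteq> x" if "m \<le> n" for n
      using that by (metis (mono_tags, lifting) lessThan_iff mem_Collect_eq not_le subsetD)
    then have "f \<in> M m" unfolding M_def x(2) char_fun_def by blast
    then show "f \<in> (\<Union>m. M m)" by blast
  qed
  ultimately show ?thesis unfolding meager_family_def by (rule meager_in_subset)
qed

section \<open>Primeness and properness of the ideal\<close>

lemma meager_family_Int_imp:
  assumes X: "downward_closed X" and Y: "downward_closed Y" and "meager_family (X \<inter> Y)"
  shows "meager_family X \<or> meager_family Y"
proof (rule disjCI)
  assume "\<not> meager_family Y"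
  obtain g where g: "\<And>n. n < g n" "\<And>x. x \<in> X \<inter> Y \<Longrightarrow> finite {n. {n..<g n} \<subseteq> x}"
    using meager_family_intervals[OF downward_closed_Int[OF X Y] assms(3)] by blast
  obtain y where y: "y \<in> Y" "infinite {n. {n..<g n} \<subseteq> y}"
    using \<open>\<not> meager_family Y\<close> meager_family_if_intervals by blast
  then have "\<forall>k. \<exists>n. n \<ge> k \<and> {n..<g n} \<subseteq> y"
    unfolding infinite_nat_iff_unbounded_le by blast
  \<comment> \<open>\<open>p k\<close> is the start of an interval inside \<open>y\<close>, at or
    after \<open>k\<close>.\<close>
  then obtain p where p: "\<And>k. k \<le> p k" "\<And>k. {p k..<g (p k)} \<subseteq> y" by metis
  show "meager_family X"
  \<comment> \<open>Stretched this far, the interval from \<open>n\<close> includes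
    \<open>{p n..<g (p n)}\<close>, which already lies in \<open>y\<close>.\<close>
  proof (rule meager_family_if_intervals[where g = "\<lambda>n. g (p n)"], rule ccontr)
    fix x assume x: "x \<in> X" and inf: "infinite {n. {n..<g (p n)} \<subseteq> x}"
    let ?B = "{m. {m..<g m} \<subseteq> x \<inter> y}"
    have "\<exists>m\<ge>k. m \<in> ?B" for k
    proof -
      obtain n where n: "n \<ge> k" "{n..<g (p n)} \<subseteq> x"
        using inf unfolding infinite_nat_iff_unbounded_le by blast
      have "{p n..<g (p n)} \<subseteq> {n..<g (p n)}" using p(1)[of n] by auto
      then have "p n \<in> ?B" using n(2) p(2)[of n] by blast
      then show ?thesis using n(1) p(1)[of n] le_trans by blast
    qed
    then have B: "infinite ?B" unfolding infinite_nat_iff_unbounded_le by blast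
    \<comment> \<open>As \<open>m < g m\<close>, every starting point \<open>m\<close> belongs to
      its own interval; thus \<open>x \<inter> y\<close> is infinite and downward closure applies to
      it.\<close>
    have "?B \<subseteq> x \<inter> y" using g(1) by fastforce
    then have "infinite (x \<inter> y)" using B finite_subset by blast
    moreover have "x \<inter> y \<subseteq>\<^sup>* x" "x \<inter> y \<subseteq>\<^sup>* y"
      by (auto simp: almost_subset_def Diff_eq_empty_iff[THEN iffD2])
    ultimately have "x \<inter> y \<in> X \<inter> Y"
      using X Y x y(1) by (auto simp: downward_closed_def infinite_subsets_def)
    then show False using g(2) B by blast
  qed
qed

text \<open>This yields properness of the ideal: \<open>UNIV\<close> contains every interval,
  whatever \<open>g\<close> is.\<close>

lemma not_meager_infinite_subsets: "\<not> meager_family infinite_subsets"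
proof
  assume "meager_family infinite_subsets"
  moreover have "downward_closed infinite_subsets" by (simp add: downward_closed_def)
  ultimately obtain g where "\<And>x. x \<in> infinite_subsets \<Longrightarrow> finite {n. {n..<g n} \<subseteq> x}"
    using meager_family_intervals by blast
  from this[of UNIV] show False by (simp add: infinite_subsets_def)
qed

theorem mainTheorem3:
  shows "lattice_prime_ideal down_lattice B_M"
proof -
  interpret Lattice.lattice down_lattice by (rule down_lattice_lattice)
  have carrier: "X \<in> carrier down_lattice \<longleftrightarrow> downward_closed X" for X
    by (simp add: down_lattice_def)
  show ?thesis
  proof unfold_locales
    show "B_M \<subseteq> carrier down_lattice" by (auto simp: B_M_def carrier)
    have "meager_family {}" by (rule meager_family_if_intervals) simp
    then have "{} \<in> B_M" by (simp add: B_M_def downward_closed_def)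
    then show "B_M \<noteq> {}" by blast
    show "X \<in> B_M" if "Y \<in> B_M" "X \<in> carrier down_lattice" "X \<sqsubseteq>\<^bsub>down_lattice\<^esub> Y" for X Y
    proof -
      have "X \<subseteq> Y" using that(3) by (simp add: down_lattice_def)
      then show ?thesis
        using that(1,2) meager_in_subset[OF _ image_mono]
        by (auto simp: B_M_def carrier meager_family_def)
    qed
    show "X \<squnion>\<^bsub>down_lattice\<^esub> Y \<in> B_M" if "X \<in> B_M" "Y \<in> B_M" for X Y
      using that by (simp add: B_M_def down_lattice_join downward_closed_Un meager_family_def
          image_Un meager_in_Un)
    have "infinite_subsets \<in> carrier down_lattice"
      by (simp add: carrier downward_closed_def)
    then show "B_M \<noteq> carrier down_lattice"
      using not_meager_infinite_subsets by (auto simp: B_M_def)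
    show "X \<in> B_M \<or> Y \<in> B_M"
      if "X \<in> carrier down_lattice" "Y \<in> carrier down_lattice" "X \<sqinter>\<^bsub>down_lattice\<^esub> Y \<in> B_M"
      for X Y
      using that meager_family_Int_imp by (auto simp: B_M_def carrier down_lattice_meet)
  qed
qed

end
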